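(* Suppose that the mirror map $\chi$ satisfies the following: $\chi=\nabla\psi^\star$ for some convex and differentiable function $\psi^\star:\mathbb{E}^\star\to\mathbb{R}$, $\chi$ takes values in $\mathcal{X}$, and $\|\chi(\xi)-\chi(\zeta)\|\le L_\chi\|\xi-\zeta\|_\star$ for all $\xi,\zeta\in\mathbb{E}^\star$. Let $r>0$ and let $\{\gamma_k\}_{k=0}^\infty$ be a sequence with $\gamma_0=1$, $\gamma_k\ge 1$ for $k\ge 1$, and $$\gamma_k=\frac{k}{r}+o(k),\qquad k\to\infty .$$ Then, with $h=\delta^2$ ($\delta>0$ being the time-step), the AMD algorithm provides a consistent one-step numerical integrator $(\zeta_k,x_k)\mapsto(\zeta_{k+1},x_{k+1})$ for the system of ODEs $$\dot\zeta(t)=-\frac{t}{r}\nabla f(x(t)),\qquad \dot x(t)=\frac{r}{t}\big(\chi(\zeta(t))-x(t)\big),$$ where $(\zeta_k,x_k)$ approximates $(\zeta(k\delta),x(k\delta))$. Consistency is understood in the sense specified in the context.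
   Context: $\mathbb{E}$ denotes $\mathbb{R}^d$ with an arbitrary norm $\|\cdot\|$, and $\mathbb{E}^\star$ is its dual with dual norm $\|\cdot\|_\star$. The set $\mathcal{X}\subseteq\mathbb{R}^d$ is non-empty, closed and convex; $f$ is a real-valued function that is convex and continuously differentiable in an open set containing $\mathcal{X}$; $\nabla f(x)\in\mathbb{E}^\star$. AMD (Accelerated Mirror Descent): given $h>0$, $\{\gamma_k\}$, $x_0\in\mathcal{X}$, $\zeta_0\in\mathbb{E}^\star$, for $k=0,1,\dots$: $$y_k=x_k+\tfrac1{\gamma_k}(\chi(\zeta_k)-x_k),\quad \zeta_{k+1}=\zeta_k-\gamma_k h\nabla f(y_k),\quad x_{k+1}=y_k+\tfrac1{\gamma_k}\big(\chi(\zeta_{k+1})-\chi(\zeta_k)\big).$$ One step of AMD is thus a map $\Psi_{k,h}:\mathbb{E}^\star\times\mathcal{X}\to\mathbb{E}^\star\times\mathcal{X}$, $(\zeta_k,x_k)\mapsto(\zeta_{k+1},x_{k+1})$. A solution of the ODE system means a continuously differentiable pair $(\zeta(t),x(t))$, $0\le t<\infty$, with values in $\mathbb{E}^\star\times\mathcal{X}$, satisfying the equations for $t>0$, with initial data $(\zeta(0),x(0))\in\mathbb{E}^\star\times\mathcal{X}$ such that $\chi(\zeta(0))=x(0)$. Consistency: the truncation error tends to zero in the limit $k\to\infty$, $\delta\to0$ with $k\delta$ constant; that is, for every solution $\xi(t)=(\zeta(t),x(t))$ and every fixed $t>0$, taking $\delta=t/k$ and $h=\delta^2$, $$\frac{\xi(t+\delta)-\xi(t)}{\delta}-\frac{\Psi_{k,\delta^2}(\xi(t))-\xi(t)}{\delta}\longrightarrow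 0\qquad\text{as }k\to\infty .$$ *)

theory Defs
  imports "HOL-Analysis.Analysis" "HOL-Library.Landau_Symbols"
begin

text \<open>
  The space E is \<open>real ^ 'n\<close> with an arbitrary norm \<open>nrm\<close>. Its dual is identified with
  \<open>real ^ 'n\<close> through the pairing \<open>s \<bullet> x\<close>, so that a gradient in the sense of
  \<open>GDERIV\<close> is the dual vector representing the derivative. Limits, continuity and derivatives
  refer to the standard topology, which is that of every norm on \<open>real ^ 'n\<close>.
\<close>

definition is_norm :: "('a::real_vector \<Rightarrow> real) \<Rightarrow> bool" where
  "is_norm nrm \<longleftrightarrow>
     (\<forall>x. nrm x = 0 \<longleftrightarrow> x = 0) \<and>
     (\<forall>a x. nrm (a *\<^sub>R x) = \<bar>a\<bar> * nrm x) \<and>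
     (\<forall>x y. nrm (x + y) \<le> nrm x + nrm y)"

definition dual_norm :: "('a::real_inner \<Rightarrow> real) \<Rightarrow> 'a \<Rightarrow> real" where
  "dual_norm nrm s = (SUP x\<in>{x. nrm x \<le> 1}. s \<bullet> x)"

text \<open>
  Convexity in a set \<open>U\<close> that is not itself required to be convex; for convex \<open>U\<close> this is
  \<open>convex_on U f\<close>.
\<close>

definition convex_in :: "'a::real_vector set \<Rightarrow> ('a \<Rightarrow> real) \<Rightarrow> bool" where
  "convex_in U f \<longleftrightarrow> (\<forall>C. convex C \<and> C \<subseteq> U \<longrightarrow> convex_on C f)"

text \<open>
  One step \<open>(\<zeta>\<^sub>k, x\<^sub>k) \<mapsto> (\<zeta>\<^sub>k\<^sub>+\<^sub>1, x\<^sub>k\<^sub>+\<^sub>1)\<close> of accelerated mirror descent,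
  where \<open>g\<close> is \<open>\<gamma>\<^sub>k\<close>, \<open>mir\<close> is the mirror map \<open>\<chi>\<close> and \<open>gradf\<close> is the gradient of
  the objective.
\<close>

definition amd_step ::
  "(real ^ 'n \<Rightarrow> real ^ 'n) \<Rightarrow> (real ^ 'n \<Rightarrow> real ^ 'n) \<Rightarrow> real \<Rightarrow> real \<Rightarrow>
   (real ^ 'n) \<times> (real ^ 'n) \<Rightarrow> (real ^ 'n) \<times> (real ^ 'n)" where
  "amd_step gradf mir g h = (\<lambda>(\<zeta>, x).
     let y = x + (1 / g) *\<^sub>R (mir \<zeta> - x);
         \<zeta>' = \<zeta> - (g * h) *\<^sub>R gradf y;
         x' = y + (1 / g) *\<^sub>R (mir \<zeta>' - mir \<zeta>)
     in (\<zeta>', x'))"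

text \<open>Continuous differentiability; one-sided at endpoints of \<open>S\<close>, unlike the two-sided
  \<open>C1_differentiable_on\<close>.\<close>

definition C1_within :: "real set \<Rightarrow> (real \<Rightarrow> 'a::real_normed_vector) \<Rightarrow> bool" where
  "C1_within S u \<longleftrightarrow>
     (\<exists>u'. (\<forall>t\<in>S. (u has_vector_derivative u' t) (at t within S)) \<and> continuous_on S u')"

definition amd_ode_solution ::
  "(real ^ 'n) set \<Rightarrow> (real ^ 'n \<Rightarrow> real ^ 'n) \<Rightarrow> (real ^ 'n \<Rightarrow> real ^ 'n) \<Rightarrow> real \<Rightarrow>
   (real \<Rightarrow> (real ^ 'n) \<times> (real ^ 'n)) \<Rightarrow> bool" where
  "amd_ode_solution X gradf mir r \<xi> \<longleftrightarrow>
     C1_within {0..} \<xi> \<and>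
     (\<forall>t\<ge>0. \<xi> t \<in> UNIV \<times> X) \<and>
     (\<forall>t>0. ((\<lambda>s. fst (\<xi> s)) has_vector_derivative - (t / r) *\<^sub>R gradf (snd (\<xi> t))) (at t) \<and>
            ((\<lambda>s. snd (\<xi> s)) has_vector_derivative
               (r / t) *\<^sub>R (mir (fst (\<xi> t)) - snd (\<xi> t))) (at t)) \<and>
     mir (fst (\<xi> 0)) = snd (\<xi> 0)"

text \<open>
  \<open>\<Phi> k \<delta>\<close> is the \<open>k\<close>-th step of a one-step method with time-step \<open>\<delta>\<close> on the state
  space \<open>D\<close>, and \<open>sol\<close> singles out the solutions of the differential equation. The step
  may depend on \<open>k\<close>, and the limit is taken at a fixed time \<open>t = k * \<delta>\<close>.
\<close>

definition one_step_method :: "'a set \<Rightarrow> (nat \<Rightarrow> real \<Rightarrow> 'a \<Rightarrow> 'a) \<Rightarrow> bool" where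
  "one_step_method D \<Phi> \<longleftrightarrow> (\<forall>k. \<forall>\<delta>>0. \<Phi> k \<delta> \<in> D \<rightarrow> D)"

definition truncation_error ::
  "(nat \<Rightarrow> real \<Rightarrow> 'a \<Rightarrow> 'a) \<Rightarrow> (real \<Rightarrow> 'a) \<Rightarrow> real \<Rightarrow> nat \<Rightarrow> real \<Rightarrow> 'a::real_vector" where
  "truncation_error \<Phi> \<xi> t k \<delta> = (\<xi> (t + \<delta>) - \<xi> t) /\<^sub>R \<delta> - (\<Phi> k \<delta> (\<xi> t) - \<xi> t) /\<^sub>R \<delta>"

definition consistent_integrator ::
  "'a set \<Rightarrow> ((real \<Rightarrow> 'a::real_normed_vector) \<Rightarrow> bool) \<Rightarrow> (nat \<Rightarrow> real \<Rightarrow> 'a \<Rightarrow> 'a) \<Rightarrow> bool" where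
  "consistent_integrator D sol \<Phi> \<longleftrightarrow>
     one_step_method D \<Phi> \<and>
     (\<forall>\<xi>. sol \<xi> \<longrightarrow>
        (\<forall>t>0. (\<lambda>k. truncation_error \<Phi> \<xi> t k (t / real k)) \<longlonglongrightarrow> 0))"

end

theory Submission
  imports Defs
begin

text \<open>
  Consistency asks only that the increment of one AMD step per unit of time converge to the
  right-hand side of the differential equations, because the difference quotient of a solution
  converges to that same right-hand side. With \<open>h = \<delta>\<^sup>2\<close> the increments per unit of time, taken
  from a point \<open>(\<zeta>, x)\<close> of the solution, are
  \<open>- (\<gamma>\<^sub>k * \<delta>) *\<^sub>R gradf y\<^sub>k\<close> for the dual variable and
  \<open>(1 / (\<gamma>\<^sub>k * \<delta>)) *\<^sub>R (mir \<zeta>' - x)\<close> for the primal one: the two occurrences of \<open>mir \<zeta>\<close> in the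
  primal update cancel. Their scalar coefficients involve only the product \<open>\<gamma>\<^sub>k * \<delta>\<close>, which tends
  to \<open>t / r\<close> because \<open>\<delta> = t / k\<close> and \<open>\<gamma>\<^sub>k = k / r + o(k)\<close>. Since
  \<open>\<gamma>\<^sub>k \<rightarrow> \<infinity>\<close> and \<open>\<gamma>\<^sub>k * \<delta>\<^sup>2 \<rightarrow> 0\<close>, the auxiliary points satisfy \<open>y\<^sub>k \<rightarrow> x\<close> and \<open>\<zeta>' \<rightarrow> \<zeta>\<close>, and continuity
  of \<open>gradf\<close> and of the mirror map gives the limit (\<open>amd_increment_tendsto\<close>).

  The same cancellation shows that the new primal point is the convex combination of \<open>x\<close> and
  \<open>mir \<zeta>'\<close> with weight \<open>1 / \<gamma>\<^sub>k\<close>, so the step stays in the feasible set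
  (\<open>amd_step_in_domain\<close>). Continuity of the mirror map comes from its Lipschitz bound, once the
  arbitrary norm has been compared with the Euclidean one (\<open>is_norm_ge_norm\<close>).
\<close>

lemma is_norm_nonneg:
  assumes "is_norm nrm"
  shows "0 \<le> nrm x"
proof -
  have "nrm (x + (-1) *\<^sub>R x) \<le> nrm x + nrm ((-1) *\<^sub>R x)"
    using assms unfolding is_norm_def by blast
  moreover have "nrm ((-1) *\<^sub>R x) = \<bar>-1\<bar> * nrm x" "nrm 0 = 0"
    using assms unfolding is_norm_def by blast+
  ultimately show ?thesis by simp
qed

text \<open>
  A norm is convex, hence continuous in finite dimension, hence bounded away from zero on the
  Euclidean unit sphere; homogeneity extends the bound to the whole space.
\<close>

lemma is_norm_ge_norm:
  fixes nrm :: "'a::euclidean_space \<Rightarrow> real"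
  assumes "is_norm nrm"
  obtains c where "c > 0" "\<And>x. c * norm x \<le> nrm x"
proof -
  have scale: "\<And>a x. nrm (a *\<^sub>R x) = \<bar>a\<bar> * nrm x" and tri: "\<And>x y. nrm (x + y) \<le> nrm x + nrm y"
    and zero: "\<And>x. nrm x = 0 \<longleftrightarrow> x = 0"
    using assms unfolding is_norm_def by blast+
  have "convex_on UNIV nrm"
  proof (rule convex_onI)
    fix a :: real and x y :: 'a
    assume "0 < a" "a < 1"
    then show "nrm ((1 - a) *\<^sub>R x + a *\<^sub>R y) \<le> (1 - a) * nrm x + a * nrm y"
      using tri[of "(1 - a) *\<^sub>R x" "a *\<^sub>R y"] by (simp add: scale)
  qed simp
  then have "continuous_on UNIV nrm"
    by (intro convex_on_continuous) auto
  then have "continuous_on (sphere 0 1) nrm"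
    by (rule continuous_on_subset) auto
  then obtain m where m: "m \<in> sphere 0 1" "\<And>y. y \<in> sphere 0 1 \<Longrightarrow> nrm m \<le> nrm y"
    using continuous_attains_inf[of "sphere (0::'a) 1" nrm] by auto
  have "nrm m \<noteq> 0" using m(1) zero by force
  with is_norm_nonneg[OF assms, of m] have pos: "nrm m > 0" by simp
  have "nrm m * norm x \<le> nrm x" for x
  proof (cases "x = 0")
    case True
    then show ?thesis using zero[of 0] by simp
  next
    case False
    then have "nrm m \<le> nrm (inverse (norm x) *\<^sub>R x)" by (intro m(2)) simp
    then show ?thesis using False by (simp add: scale field_simps)
  qed
  with pos show thesis using that by blast
qed

text \<open>
  The unit ball of \<open>nrm\<close> lies in the Euclidean ball of radius \<open>1 / c\<close>. So the supremum defining
  the dual norm is over a bounded set, and Cauchy-Schwarz applies.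
\<close>

lemma dual_norm_bounds:
  fixes s :: "'a::real_inner"
  assumes "is_norm nrm" "c > 0" and lower: "\<And>x. c * norm x \<le> nrm x"
  shows "0 \<le> dual_norm nrm s" "dual_norm nrm s \<le> norm s / c"
proof -
  have bound: "s \<bullet> x \<le> norm s / c" if "nrm x \<le> 1" for x
  proof -
    have "norm x \<le> 1 / c" using lower[of x] that \<open>c > 0\<close> by (simp add: field_simps)
    then have "norm s * norm x \<le> norm s * (1 / c)" by (rule mult_left_mono) simp
    then show ?thesis using norm_cauchy_schwarz[of s x] by simp
  qed
  have zero: "nrm 0 \<le> 1" using assms(1) unfolding is_norm_def by (metis zero_le_one)
  show "dual_norm nrm s \<le> norm s / c"
    unfolding dual_norm_def using zero bound by (intro cSUP_least) auto
  have "s \<bullet> 0 \<le> dual_norm nrm s"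
    unfolding dual_norm_def using zero bound by (intro cSUP_upper) (auto intro!: bdd_aboveI2)
  then show "0 \<le> dual_norm nrm s" by simp
qed

text \<open>
  Both norms are comparable with the Euclidean one, in the directions needed here: the norm of a
  difference of values dominates its Euclidean norm, and the dual norm of a difference of arguments
  is dominated by its Euclidean norm. Since \<open>L\<close> has no prescribed sign, the bound is first weakened
  to \<open>\<bar>L\<bar>\<close>.
\<close>

lemma continuous_on_if_dual_Lipschitz:
  fixes F :: "'a::euclidean_space \<Rightarrow> 'a"
  assumes "is_norm nrm"
    and lip: "\<And>\<xi> \<zeta>. nrm (F \<xi> - F \<zeta>) \<le> L * dual_norm nrm (\<xi> - \<zeta>)"
  shows "continuous_on UNIV F"
proof -
  obtain c where c: "c > 0" "\<And>x. c * norm x \<le> nrm x"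
    using is_norm_ge_norm[OF assms(1)] by blast
  have "dist (F \<xi>) (F \<zeta>) \<le> \<bar>L\<bar> / c / c * dist \<xi> \<zeta>" for \<xi> \<zeta>
  proof -
    note dual = dual_norm_bounds[OF assms(1) c, of "\<xi> - \<zeta>"]
    have "c * norm (F \<xi> - F \<zeta>) \<le> L * dual_norm nrm (\<xi> - \<zeta>)"
      using c(2) lip order_trans by blast
    also have "\<dots> \<le> \<bar>L\<bar> * dual_norm nrm (\<xi> - \<zeta>)" using dual(1) by (intro mult_right_mono) auto
    also have "\<dots> \<le> \<bar>L\<bar> * (norm (\<xi> - \<zeta>) / c)" using dual(2) by (intro mult_left_mono) auto
    finally show ?thesis using c(1) by (simp add: dist_norm field_simps)
  qed
  then have "(\<bar>L\<bar> / c / c)-lipschitz_on UNIV F"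
    using c(1) by (intro lipschitz_onI) auto
  then show ?thesis by (rule lipschitz_on_continuous_on)
qed

text \<open>
  The occurrences of \<open>mir \<zeta>\<close> in the interpolation and in the correction of the primal point
  cancel, which leaves \<open>mir \<zeta>\<close> only inside the argument of \<open>gradf\<close>.
\<close>

lemma amd_step_eq:
  "amd_step gradf mir g h (\<zeta>, x) =
     (let \<zeta>' = \<zeta> - (g * h) *\<^sub>R gradf (x + (1 / g) *\<^sub>R (mir \<zeta> - x))
      in (\<zeta>', x + (1 / g) *\<^sub>R (mir \<zeta>' - x)))"
  by (simp add: amd_step_def Let_def algebra_simps)

text \<open>
  The condition \<open>g \<ge> 1\<close> makes \<open>1 / g\<close> a convex weight between the old primal point and a value
  of the mirror map.
\<close>

lemma amd_step_in_domain:
  assumes "convex X" "\<And>\<zeta>. mir \<zeta> \<in> X" "g \<ge> 1"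
  shows "amd_step gradf mir g h \<in> UNIV \<times> X \<rightarrow> UNIV \<times> X"
proof -
  have "x + (1 / g) *\<^sub>R (z - x) \<in> X" if "x \<in> X" "z \<in> X" for x z
  proof -
    have "(1 - 1 / g) *\<^sub>R x + (1 / g) *\<^sub>R z \<in> X"
      using assms(1,3) that by (intro convexD_alt) auto
    then show ?thesis by (simp add: algebra_simps)
  qed
  with assms(2) show ?thesis by (auto simp: amd_step_eq Let_def)
qed

lemma difference_quotient_sequentially:
  assumes "(u has_vector_derivative u') (at t)" "\<And>k. \<delta> k \<noteq> 0" "\<delta> \<longlonglongrightarrow> 0"
  shows "(\<lambda>k. (u (t + \<delta> k) - u t) /\<^sub>R \<delta> k) \<longlonglongrightarrow> u'"
proof -
  have "((\<lambda>h. norm (u (t + h) - u t - h *\<^sub>R u') / norm h) \<longlongrightarrow> 0) (at 0)"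
    using assms(1) unfolding has_vector_derivative_def has_derivative_at by blast
  moreover have "filterlim \<delta> (at 0) sequentially"
    using assms(2,3) by (simp add: filterlim_at)
  ultimately have
    "(\<lambda>k. norm (u (t + \<delta> k) - u t - \<delta> k *\<^sub>R u') / norm (\<delta> k)) \<longlonglongrightarrow> 0"
    by (rule filterlim_compose)
  moreover have "norm (u (t + \<delta> k) - u t - \<delta> k *\<^sub>R u') / norm (\<delta> k)
      = norm ((u (t + \<delta> k) - u t) /\<^sub>R \<delta> k - u')" for k
  proof -
    have "(u (t + \<delta> k) - u t) /\<^sub>R \<delta> k - u' = (u (t + \<delta> k) - u t - \<delta> k *\<^sub>R u') /\<^sub>R \<delta> k"
      using assms(2)[of k] by (simp add: scaleR_diff_right)
    then show ?thesis by (simp add: divide_inverse_commute)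
  qed
  ultimately have "(\<lambda>k. (u (t + \<delta> k) - u t) /\<^sub>R \<delta> k - u') \<longlonglongrightarrow> 0"
    by (simp add: tendsto_norm_zero_iff)
  then show ?thesis by (simp add: LIM_zero_iff)
qed

text \<open>
  The increment of a step per unit of time, for general sequences of coefficients \<open>g\<close> and
  time-steps \<open>\<delta>\<close>: the limit of \<open>g k * \<delta> k\<close> is all that survives.
\<close>

lemma amd_increment_tendsto:
  fixes \<zeta> x :: "real ^ 'n"
  assumes gradf: "isCont gradf x" and mir: "isCont mir \<zeta>"
    and g: "filterlim g at_top sequentially"
    and \<delta>: "\<delta> \<longlonglongrightarrow> 0" "\<And>k. \<delta> k \<noteq> 0"
    and g\<delta>: "(\<lambda>k. g k * \<delta> k) \<longlonglongrightarrow> c" and "c \<noteq> 0"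
  shows "(\<lambda>k. (amd_step gradf mir (g k) ((\<delta> k)\<^sup>2) (\<zeta>, x) - (\<zeta>, x)) /\<^sub>R \<delta> k)
           \<longlonglongrightarrow> (- c *\<^sub>R gradf x, (1 / c) *\<^sub>R (mir \<zeta> - x))"
proof -
  define y where "y k = x + (1 / g k) *\<^sub>R (mir \<zeta> - x)" for k
  define \<zeta>' where "\<zeta>' k = \<zeta> - (g k * (\<delta> k)\<^sup>2) *\<^sub>R gradf (y k)" for k
  have "(\<lambda>k. 1 / g k) \<longlonglongrightarrow> 0"
    using g by (intro tendsto_divide_0[OF tendsto_const] filterlim_at_top_imp_at_infinity)
  then have "y \<longlonglongrightarrow> x + 0 *\<^sub>R (mir \<zeta> - x)" unfolding y_def by (intro tendsto_intros)
  then have grad_lim: "(\<lambda>k. gradf (y k)) \<longlonglongrightarrow> gradf x"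
    using isCont_tendsto_compose[OF gradf] by simp
  have "(\<lambda>k. g k * \<delta> k * \<delta> k) \<longlonglongrightarrow> c * 0" by (intro tendsto_intros g\<delta> \<delta>)
  then have "\<zeta>' \<longlonglongrightarrow> \<zeta> - 0 *\<^sub>R gradf x"
    unfolding \<zeta>'_def by (intro tendsto_intros grad_lim) (simp add: power2_eq_square mult.assoc)
  then have mir_lim: "(\<lambda>k. mir (\<zeta>' k)) \<longlonglongrightarrow> mir \<zeta>"
    using isCont_tendsto_compose[OF mir] by simp
  have "(amd_step gradf mir (g k) ((\<delta> k)\<^sup>2) (\<zeta>, x) - (\<zeta>, x)) /\<^sub>R \<delta> k
      = (- (g k * \<delta> k) *\<^sub>R gradf (y k), (1 / (g k * \<delta> k)) *\<^sub>R (mir (\<zeta>' k) - x))" for k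
    using \<delta>(2)[of k] unfolding amd_step_eq Let_def y_def[symmetric] \<zeta>'_def[symmetric]
    by (simp add: \<zeta>'_def power2_eq_square divide_inverse mult.commute)
  moreover have "(\<lambda>k. (- (g k * \<delta> k) *\<^sub>R gradf (y k), (1 / (g k * \<delta> k)) *\<^sub>R (mir (\<zeta>' k) - x)))
      \<longlonglongrightarrow> (- c *\<^sub>R gradf x, (1 / c) *\<^sub>R (mir \<zeta> - x))"
    using \<open>c \<noteq> 0\<close> by (intro tendsto_intros g\<delta> grad_lim mir_lim)
  ultimately show ?thesis by simp
qed

theorem theorem1:
  fixes nrm :: "real ^ 'n \<Rightarrow> real"
    and X U :: "(real ^ 'n) set"
    and f :: "real ^ 'n \<Rightarrow> real"
    and gradf :: "real ^ 'n \<Rightarrow> real ^ 'n"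
    and mir :: "real ^ 'n \<Rightarrow> real ^ 'n"
    and \<psi> :: "real ^ 'n \<Rightarrow> real"
    and L r :: real
    and \<gamma> :: "nat \<Rightarrow> real"
  assumes "is_norm nrm"
    and "X \<noteq> {}" "closed X" "convex X"
    and "open U" "X \<subseteq> U" "convex_in U f"
    and "\<And>x. x \<in> U \<Longrightarrow> GDERIV f x :> gradf x"
    and "continuous_on U gradf"
    and "convex_on UNIV \<psi>"
    and "\<And>\<zeta>. GDERIV \<psi> \<zeta> :> mir \<zeta>"
    and "\<And>\<zeta>. mir \<zeta> \<in> X"
    and "\<And>\<xi> \<zeta>. nrm (mir \<xi> - mir \<zeta>) \<le> L * dual_norm nrm (\<xi> - \<zeta>)"
    and "r > 0"
    and "\<gamma> 0 = 1" "\<And>k. k \<ge> 1 \<Longrightarrow> \<gamma> k \<ge> 1"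
    and "(\<lambda>k. \<gamma> k - real k / r) \<in> o(\<lambda>k. real k)"
  shows "consistent_integrator (UNIV \<times> X) (amd_ode_solution X gradf mir r)
           (\<lambda>k \<delta>. amd_step gradf mir (\<gamma> k) (\<delta>\<^sup>2))"
proof -
  let ?\<Phi> = "\<lambda>k \<delta>. amd_step gradf mir (\<gamma> k) (\<delta>\<^sup>2)"
  have \<gamma>_ge: "\<gamma> k \<ge> 1" for k using assms(15,16) by (cases k) auto
  have "(\<lambda>k. (\<gamma> k - real k / r) / real k) \<longlonglongrightarrow> 0"
    by (rule smalloD_tendsto[OF assms(17)])
  then have "(\<lambda>k. (\<gamma> k - real k / r) / real k + 1 / r) \<longlonglongrightarrow> 0 + 1 / r" by (intro tendsto_intros)
  moreover have "\<forall>\<^sub>F k in sequentially. (\<gamma> k - real k / r) / real k + 1 / r = \<gamma> k / real k"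
    using eventually_gt_at_top[of 0] by eventually_elim (simp add: diff_divide_distrib)
  ultimately have \<gamma>_ratio: "(\<lambda>k. \<gamma> k / real k) \<longlonglongrightarrow> 1 / r"
    using Lim_transform_eventually by fastforce
  have "filterlim (\<lambda>k. \<gamma> k / real k * real k) at_top sequentially"
    using \<open>r > 0\<close> by (intro filterlim_tendsto_pos_mult_at_top[OF \<gamma>_ratio] filterlim_real_sequentially) auto
  moreover have "\<forall>\<^sub>F k in sequentially. \<gamma> k / real k * real k = \<gamma> k"
    using eventually_gt_at_top[of 0] by eventually_elim simp
  ultimately have \<gamma>_top: "filterlim \<gamma> at_top sequentially"
    using filterlim_cong[OF refl refl] by fast
  have mir_cont: "continuous_on UNIV mir"
    using assms(1,13) by (rule continuous_on_if_dual_Lipschitz)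
  have "(\<lambda>k. truncation_error ?\<Phi> \<xi> t k (t / real k)) \<longlonglongrightarrow> 0"
    if sol: "amd_ode_solution X gradf mir r \<xi>" and "t > 0" for \<xi> t
  proof -
    obtain \<zeta> x where \<xi>t: "\<xi> t = (\<zeta>, x)" by (cases "\<xi> t")
    let ?D = "(- (t / r) *\<^sub>R gradf x, (1 / (t / r)) *\<^sub>R (mir \<zeta> - x))"
    have "\<xi> t \<in> UNIV \<times> X"
      using sol \<open>t > 0\<close> unfolding amd_ode_solution_def by simp
    then have "x \<in> U" using \<open>X \<subseteq> U\<close> \<xi>t by auto
    have "((\<lambda>s. (fst (\<xi> s), snd (\<xi> s))) has_vector_derivative ?D) (at t)"
      using sol \<open>t > 0\<close> \<xi>t unfolding amd_ode_solution_def
      by (intro has_vector_derivative_Pair) auto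
    then have deriv: "(\<xi> has_vector_derivative ?D) (at t)" by simp
    \<comment> \<open>The shift by one avoids the division by zero in the step \<open>t / real 0\<close>.\<close>
    define \<delta> where "\<delta> k = t / real (Suc k)" for k
    have \<delta>: "\<delta> \<longlonglongrightarrow> 0" "\<And>k. \<delta> k \<noteq> 0"
      using \<open>t > 0\<close> lim_const_over_n[of t, THEN LIMSEQ_Suc] unfolding \<delta>_def by auto
    have "(\<lambda>k. t * (\<gamma> (Suc k) / real (Suc k))) \<longlonglongrightarrow> t * (1 / r)"
      by (intro tendsto_intros LIMSEQ_Suc[OF \<gamma>_ratio])
    then have \<gamma>\<delta>: "(\<lambda>k. \<gamma> (Suc k) * \<delta> k) \<longlonglongrightarrow> t / r"
      by (simp add: \<delta>_def mult.commute)
    have "(\<lambda>k. (?\<Phi> (Suc k) (\<delta> k) (\<zeta>, x) - (\<zeta>, x)) /\<^sub>R \<delta> k) \<longlonglongrightarrow> ?D"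
    proof (rule amd_increment_tendsto)
      show "isCont gradf x"
        using \<open>continuous_on U gradf\<close> \<open>open U\<close> \<open>x \<in> U\<close> by (simp add: continuous_on_eq_continuous_at)
      show "isCont mir \<zeta>"
        using mir_cont by (simp add: continuous_on_eq_continuous_at)
      show "filterlim (\<lambda>k. \<gamma> (Suc k)) at_top sequentially"
        using \<gamma>_top by (rule filterlim_compose) (rule filterlim_Suc)
    qed (use \<delta> \<gamma>\<delta> \<open>t > 0\<close> \<open>r > 0\<close> in auto)
    with difference_quotient_sequentially[OF deriv \<delta>(2,1)]
    have "(\<lambda>k. (\<xi> (t + \<delta> k) - \<xi> t) /\<^sub>R \<delta> k - (?\<Phi> (Suc k) (\<delta> k) (\<xi> t) - \<xi> t) /\<^sub>R \<delta> k)
        \<longlonglongrightarrow> ?D - ?D"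
      unfolding \<xi>t by (rule tendsto_diff)
    then have "(\<lambda>k. truncation_error ?\<Phi> \<xi> t (Suc k) (t / real (Suc k))) \<longlonglongrightarrow> 0"
      unfolding truncation_error_def \<delta>_def by simp
    then show ?thesis by (rule LIMSEQ_imp_Suc)
  qed
  moreover have "one_step_method (UNIV \<times> X) ?\<Phi>"
    unfolding one_step_method_def
  proof (intro allI impI)
    show "?\<Phi> k \<delta> \<in> UNIV \<times> X \<rightarrow> UNIV \<times> X" for k \<delta>
      using \<open>convex X\<close> assms(12) \<gamma>_ge by (rule amd_step_in_domain)
  qed
  ultimately show ?thesis
    unfolding consistent_integrator_def by blast
qed

end
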